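(* Let $k$ and $\ell$ be arbitrary positive integers. The $(0,1)$-matrix $B_k^{\ell-2}$ is dense, of the same order as $A_k^{\ell-2}$, and such that $$B_k^{\ell-2}=\mathbb{J}-A_k^{\ell-2},$$ where $\mathbb{J}$ is the matrix of that order filled with ones.
   Context: A $(0,1)$-matrix is a matrix all of whose entries are $0$ or $1$. "Dense" is not formally defined by the authors; it is used as the opposite of "sparse", a sparse matrix being a $(0,1)$-matrix in which most of the elements are zero. $C^a_b$ denotes the binomial coefficient "$a$ choose $b$". $I_p$ is the $p\times p$ identity matrix and $J_p$ is the $p\times p$ all-ones matrix minus $I_p$. If $X$ has $m$ columns and $Y$ is $m\times m$, then $X(Y)$ denotes the matrix obtained by pasting $Y$ below $X$. For $X$ of order $n_1\times m_1$ and $Y$ of order $n_2\times m_2$ with $n_1\ge n_2$, let $X\sqcup_0 Y$ (respectively $X\sqcup_1 Y$) be the $n_1\times(m_1+m_2)$ matrix obtained by placing $Y$ to the right of $X$ with the bottom rows aligned and filling the remaining upper right $(n_1-n_2)\times m_2$ block with zeros (respectively with ones); longer expressions are formed from left to right. The matrices $A_k^{j}$ ($k\ge1$, $j\ge-1$): $A_k^{-1}=(1,\ldots,1)$ of order $1\times k$ and, for $j\ge0$, $A_k^{j}=A_k^{j-1}(I_{C^{k+j}_{j+1}})\sqcup_0 A_{k-1}^{j-1}(I_{C^{k-1+j}_{j+1}})\sqcup_0\cdots\sqcup_0 A_1^{j-1}(I_{C^{1+j}_{j+1}})$. The matrices $B_k^{j}$ ($k\ge1$, $j\ge-1$): $B_k^{-1}=(0,\ldots,0)$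 of order $1\times k$ and, for $j\ge0$, $B_k^{j}=B_k^{j-1}(J_{C^{k+j}_{j+1}})\sqcup_1 B_{k-1}^{j-1}(J_{C^{k-1+j}_{j+1}})\sqcup_1\cdots\sqcup_1 B_1^{j-1}(J_{C^{1+j}_{j+1}})$. In both cases the pasted square matrices have as many rows as the matrix above them has columns.
   Formalization: "Dense" is read as more than half the entries being 1; since B is the zero matrix when k=1 or ℓ=1, density is not claimed for all k,ℓ but proved to hold exactly when k,ℓ≥2 and (k,ℓ) is not (2,2), (2,3) or (3,2); the other claims hold for all k,ℓ≥1. *)

theory Defs
  imports "Jordan_Normal_Form.Matrix"
begin

definition zero_one_mat :: "int mat \<Rightarrow> bool" where
  "zero_one_mat M \<longleftrightarrow> elements_mat M \<subseteq> {0, 1}"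

definition entry_count :: "int \<Rightarrow> int mat \<Rightarrow> nat" where
  "entry_count x M = card {(i, j). i < dim_row M \<and> j < dim_col M \<and> M $$ (i, j) = x}"

(* A sparse matrix is a (0,1)-matrix most of whose elements are zero, and "dense" is
   the opposite notion, so here most (more than half) of the elements are one. *)
definition dense_mat :: "int mat \<Rightarrow> bool" where
  "dense_mat M \<longleftrightarrow> zero_one_mat M \<and> dim_row M * dim_col M < 2 * entry_count 1 M"

definition all_ones :: "nat \<Rightarrow> nat \<Rightarrow> int mat" where
  "all_ones nr nc = mat nr nc (\<lambda>_. 1)"

definition J_mat :: "nat \<Rightarrow> int mat" where
  "J_mat p = all_ones p p - 1\<^sub>m p"

(* join c X Y is X \<squnion>_c Y.  It is meant for dim_row Y \<le> dim_row X. *)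
definition join :: "int \<Rightarrow> int mat \<Rightarrow> int mat \<Rightarrow> int mat" where
  "join c X Y = mat (dim_row X) (dim_col X + dim_col Y)
     (\<lambda>(i, j).
        if j < dim_col X then X $$ (i, j)
        else if i < dim_row X - dim_row Y then c
        else Y $$ (i - (dim_row X - dim_row Y), j - dim_col X))"

(* A_mat k j is A_k^j, for k \<ge> 1 and j \<ge> -1.  X(Y) is X @\<^sub>r Y, and foldl gives the
   bracketing from left to right over the indices k, k-1, ..., 1. *)
function A_mat :: "nat \<Rightarrow> int \<Rightarrow> int mat" where
  "A_mat k j =
     (if j < 0 then mat 1 k (\<lambda>_. 1)
      else foldl (join 0)
             (A_mat k (j - 1) @\<^sub>r 1\<^sub>m ((k + nat j) choose (nat j + 1)))
             (map (\<lambda>i. A_mat i (j - 1) @\<^sub>r 1\<^sub>m ((i + nat j) choose (nat j + 1))) (rev [1..<k])))"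
  by auto
termination by (relation "measure (\<lambda>(k, j). nat (j + 1))") auto

function B_mat :: "nat \<Rightarrow> int \<Rightarrow> int mat" where
  "B_mat k j =
     (if j < 0 then mat 1 k (\<lambda>_. 0)
      else foldl (join 1)
             (B_mat k (j - 1) @\<^sub>r J_mat ((k + nat j) choose (nat j + 1)))
             (map (\<lambda>i. B_mat i (j - 1) @\<^sub>r J_mat ((i + nat j) choose (nat j + 1))) (rev [1..<k])))"
  by auto
termination by (relation "measure (\<lambda>(k, j). nat (j + 1))") auto

(* The unconditional recursion equations would make the simplifier loop. *)
declare A_mat.simps [simp del] B_mat.simps [simp del]

end

(* A column of A_k^(l-2) carries exactly l ones, since every level of the recursion pastes one more
   identity matrix below it.  Complementation interchanges the two constructions, so all columns of
   B_k^(l-2) have R - l ones, where R = C(k+l-1, l-1) is the number of rows, and B_k^(l-2) is dense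
   if and only if 2 l < R. *)
theory Submission
  imports Defs
begin

definition complement_mat :: "int mat \<Rightarrow> int mat" where
  "complement_mat X = all_ones (dim_row X) (dim_col X) - X"

lemma dim_complement_mat [simp]:
  "dim_row (complement_mat X) = dim_row X" "dim_col (complement_mat X) = dim_col X"
  by (simp_all add: complement_mat_def all_ones_def)

lemma index_complement_mat [simp]:
  "i < dim_row X \<Longrightarrow> j < dim_col X \<Longrightarrow> complement_mat X $$ (i, j) = 1 - X $$ (i, j)"
  by (simp add: complement_mat_def all_ones_def)

lemma dim_join [simp]:
  "dim_row (join c X Y) = dim_row X" "dim_col (join c X Y) = dim_col X + dim_col Y"
  by (simp_all add: join_def)

lemma dim_append_rows [simp]:
  "dim_row (X @\<^sub>r Y) = dim_row X + dim_row Y" "dim_col (X @\<^sub>r Y) = dim_col X"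
  by (simp_all add: append_rows_def)

lemma index_append_rows:
  assumes "i < dim_row X + dim_row Y" "j < dim_col X" "dim_col Y = dim_col X"
  shows "(X @\<^sub>r Y) $$ (i, j) = (if i < dim_row X then X $$ (i, j) else Y $$ (i - dim_row X, j))"
  using assms by (simp add: append_rows_def)

text \<open>Complementation turns the padding zeros into ones, which is what converts the recursion
  of \<open>A_mat\<close> into that of \<open>B_mat\<close>.\<close>

lemma complement_join:
  assumes "dim_row Y \<le> dim_row X"
  shows "complement_mat (join 0 X Y) = join 1 (complement_mat X) (complement_mat Y)"
  using assms by (intro eq_matI) (auto simp: join_def)

lemma complement_append_rows:
  assumes "dim_col Y = dim_col X"
  shows "complement_mat (X @\<^sub>r Y) = complement_mat X @\<^sub>r complement_mat Y"
  using assms by (intro eq_matI) (auto simp: index_append_rows)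

lemma complement_one_mat: "complement_mat (1\<^sub>m p) = J_mat p"
  by (simp add: complement_mat_def J_mat_def)

text \<open>\<open>join\<close> keeps the row count of its first argument, so the accumulator has as
  many rows as \<open>X\<close> throughout the fold.\<close>

lemma complement_foldl_join:
  assumes "\<And>Y. Y \<in> set Ys \<Longrightarrow> dim_row Y \<le> dim_row X"
  shows "complement_mat (foldl (join 0) X Ys)
    = foldl (join 1) (complement_mat X) (map complement_mat Ys)"
  using assms by (induction Ys arbitrary: X) (auto simp: complement_join)

text \<open>Levels are written \<open>int n - 1\<close>, so that induction on the natural number n
  covers every level from -1 on.\<close>

lemma A_mat_0: "A_mat k (int 0 - 1) = mat 1 k (\<lambda>_. 1)"
  by (subst A_mat.simps) simp

lemma A_mat_Suc:
  "A_mat k (int (Suc n) - 1) =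
     foldl (join 0) (A_mat k (int n - 1) @\<^sub>r 1\<^sub>m ((k + n) choose Suc n))
       (map (\<lambda>i. A_mat i (int n - 1) @\<^sub>r 1\<^sub>m ((i + n) choose Suc n)) (rev [1..<k]))"
  by (subst A_mat.simps) simp

lemma B_mat_0: "B_mat k (int 0 - 1) = mat 1 k (\<lambda>_. 0)"
  by (subst B_mat.simps) simp

lemma B_mat_Suc:
  "B_mat k (int (Suc n) - 1) =
     foldl (join 1) (B_mat k (int n - 1) @\<^sub>r J_mat ((k + n) choose Suc n))
       (map (\<lambda>i. B_mat i (int n - 1) @\<^sub>r J_mat ((i + n) choose Suc n)) (rev [1..<k]))"
  by (subst B_mat.simps) simp

text \<open>The order belongs to the invariant because pasting requires matching widths and joining
  compares heights. As entries are 0 or 1, s is the number of ones in each column.\<close>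

definition const_col_mat :: "nat \<Rightarrow> nat \<Rightarrow> nat \<Rightarrow> int mat \<Rightarrow> bool" where
  "const_col_mat s r c X \<longleftrightarrow> X \<in> carrier_mat r c
     \<and> (\<forall>i<r. \<forall>j<c. X $$ (i, j) \<in> {0, 1})
     \<and> (\<forall>j<c. (\<Sum>i<r. X $$ (i, j)) = int s)"

lemma const_col_mat_dim:
  "const_col_mat s r c X \<Longrightarrow> dim_row X = r" "const_col_mat s r c X \<Longrightarrow> dim_col X = c"
  by (auto simp: const_col_mat_def)

lemma const_col_mat_one: "const_col_mat 1 p p (1\<^sub>m p)"
  by (auto simp: const_col_mat_def one_mat_def)

lemma sum_lessThan_add:
  fixes f :: "nat \<Rightarrow> int"
  shows "(\<Sum>i<m + n. f i) = (\<Sum>i<m. f i) + (\<Sum>i<n. f (m + i))"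
  by (induction n) (simp_all add: algebra_simps)

lemma const_col_mat_append_rows:
  assumes "const_col_mat s r c X" "const_col_mat t p c Y"
  shows "const_col_mat (s + t) (r + p) c (X @\<^sub>r Y)"
  unfolding const_col_mat_def
proof (intro conjI allI impI)
  note dims = const_col_mat_dim[OF assms(1)] const_col_mat_dim[OF assms(2)]
  show "X @\<^sub>r Y \<in> carrier_mat (r + p) c"
    using dims by (intro carrier_matI) auto
  fix j assume j: "j < c"
  show "(X @\<^sub>r Y) $$ (i, j) \<in> {0, 1}" if "i < r + p" for i
    using assms that j dims by (auto simp: index_append_rows const_col_mat_def)
  show "(\<Sum>i<r + p. (X @\<^sub>r Y) $$ (i, j)) = int (s + t)"
    using assms j dims by (simp add: sum_lessThan_add index_append_rows const_col_mat_def)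
qed

text \<open>Columns of \<open>Y\<close> are lengthened by zeros only, so their sums do not
  change.\<close>

lemma const_col_mat_join:
  assumes X: "const_col_mat s r c X" and Y: "const_col_mat s p d Y" and "p \<le> r"
  shows "const_col_mat s r (c + d) (join 0 X Y)"
  unfolding const_col_mat_def
proof (intro conjI allI impI)
  note dims = const_col_mat_dim[OF X] const_col_mat_dim[OF Y]
  show "join 0 X Y \<in> carrier_mat r (c + d)"
    using dims by (intro carrier_matI) auto
  fix j assume j: "j < c + d"
  show "join 0 X Y $$ (i, j) \<in> {0, 1}" if "i < r" for i
    using assms that j dims by (auto simp: join_def const_col_mat_def)
  show "(\<Sum>i<r. join 0 X Y $$ (i, j)) = int s"
  proof (cases "j < c")
    case True
    then show ?thesis using X dims by (simp add: join_def const_col_mat_def)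
  next
    case False
    \<comment> \<open>Row \<open>r - p + i\<close> of the join is row i of \<open>Y\<close>;
      simplification rewrites this index to \<open>r + i - p\<close>, hence the form of these
      facts.\<close>
    have "r + i - p < r - p \<longleftrightarrow> False" "r + i - p - (r - p) = i" for i
      using \<open>p \<le> r\<close> by auto
    then have "(\<Sum>i<(r - p) + p. join 0 X Y $$ (i, j)) = (\<Sum>i<p. Y $$ (i, j - c))"
      using False j \<open>p \<le> r\<close> unfolding sum_lessThan_add by (simp add: join_def dims)
    then show ?thesis
      using False j Y \<open>p \<le> r\<close> by (simp add: const_col_mat_def)
  qed
qed

lemma const_col_mat_foldl_join:
  assumes "const_col_mat s r c X"
    and "\<And>i. i \<in> set is \<Longrightarrow> const_col_mat s (p i) (d i) (F i) \<and> p i \<le> r"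
  shows "const_col_mat s r (c + (\<Sum>i\<leftarrow>is. d i)) (foldl (join 0) X (map F is))"
  using assms
proof (induction "is" arbitrary: c X)
  case (Cons i "is")
  have "const_col_mat s r (c + d i) (join 0 X (F i))"
    using Cons.prems by (intro const_col_mat_join) auto
  then show ?case
    using Cons.IH[of "c + d i" "join 0 X (F i)"] Cons.prems(2) by (simp add: add.assoc)
qed simp

text \<open>Repeated use of Pascal's rule. The block widths at one level add up to the size of the
  identity pasted at the next.\<close>

lemma hockey_stick:
  "((k + n) choose Suc n) + (\<Sum>i\<leftarrow>rev [1..<k]. (i + n) choose Suc n)
    = (k + Suc n) choose Suc (Suc n)"
proof (induction k)
  case (Suc k)
  \<comment> \<open>\<open>[1..<Suc k]\<close> ends in k only if k is positive; for k = 0 it is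
    empty.\<close>
  then show ?case by (cases k) simp_all
qed simp

text \<open>Order and column sums go through one induction, since each pasted identity must fit the
  width above it. Pascal's rule gives the new height, \<open>hockey_stick\<close> the new
  width.\<close>

lemma const_col_A_mat:
  "const_col_mat (Suc n) ((k + n) choose n) ((k + n) choose Suc n) (A_mat k (int n - 1))"
proof (induction n arbitrary: k)
  case 0
  then show ?case unfolding A_mat_0 by (auto simp: const_col_mat_def)
next
  case (Suc n)
  have blk: "const_col_mat (Suc (Suc n)) ((i + Suc n) choose Suc n) ((i + n) choose Suc n)
      (A_mat i (int n - 1) @\<^sub>r 1\<^sub>m ((i + n) choose Suc n))" for i
    using const_col_mat_append_rows[OF Suc.IH const_col_mat_one, of i] by simp
  have "(i + Suc n) choose Suc n \<le> (k + Suc n) choose Suc n" if "i < k" for i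
    using that by (intro binomial_right_mono) simp
  then have "const_col_mat (Suc (Suc n)) ((k + Suc n) choose Suc n)
      (((k + n) choose Suc n) + (\<Sum>i\<leftarrow>rev [1..<k]. (i + n) choose Suc n))
      (A_mat k (int (Suc n) - 1))"
    unfolding A_mat_Suc using blk
    by (intro const_col_mat_foldl_join[where p = "\<lambda>i. (i + Suc n) choose Suc n"]) auto
  then show ?case unfolding hockey_stick .
qed

lemma B_mat_eq_complement: "B_mat k (int n - 1) = complement_mat (A_mat k (int n - 1))"
proof (induction n arbitrary: k)
  case 0
  then show ?case
    unfolding A_mat_0 B_mat_0 by (intro eq_matI) auto
next
  case (Suc n)
  note dims = const_col_mat_dim[OF const_col_A_mat]
  have blk: "complement_mat (A_mat i (int n - 1) @\<^sub>r 1\<^sub>m ((i + n) choose Suc n))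
      = B_mat i (int n - 1) @\<^sub>r J_mat ((i + n) choose Suc n)" for i
    by (simp add: complement_append_rows complement_one_mat dims Suc.IH)
  \<comment> \<open>The heights stay unsimplified sums, as \<open>dim_append_rows\<close> produces
    them when the row condition of \<open>complement_foldl_join\<close> is checked.\<close>
  have mono: "((i + n) choose n) + ((i + n) choose Suc n)
      \<le> ((k + n) choose n) + ((k + n) choose Suc n)" if "i < k" for i
    using that by (intro add_mono binomial_right_mono) auto
  show ?case
    unfolding A_mat_Suc B_mat_Suc
    by (subst complement_foldl_join) (auto simp: dims mono blk o_def)
qed

text \<open>A 0/1 entry is its own indicator of being 1, so counting is summing; the order of
  summation suits known column sums.\<close>

lemma entry_count_1_eq_sum:
  assumes "\<And>i j. i < dim_row M \<Longrightarrow> j < dim_col M \<Longrightarrow> M $$ (i, j) \<in> {0, 1}"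
  shows "int (entry_count 1 M) = (\<Sum>j<dim_col M. \<Sum>i<dim_row M. M $$ (i, j))"
proof -
  let ?D = "{..<dim_row M} \<times> {..<dim_col M}"
  have "{(i, j). i < dim_row M \<and> j < dim_col M \<and> M $$ (i, j) = 1} = {p \<in> ?D. M $$ p = 1}"
    by auto
  then have "int (entry_count 1 M) = (\<Sum>p\<in>?D. if M $$ p = 1 then 1 else 0)"
    by (simp add: entry_count_def sum.If_cases Int_def)
  also have "\<dots> = (\<Sum>p\<in>?D. M $$ p)"
    using assms by (intro sum.cong) force+
  also have "\<dots> = (\<Sum>j<dim_col M. \<Sum>i<dim_row M. M $$ (i, j))"
    by (subst sum.swap) (simp add: sum.cartesian_product)
  finally show ?thesis .
qed

lemma zero_one_mat_iff:
  "zero_one_mat M \<longleftrightarrow> (\<forall>i<dim_row M. \<forall>j<dim_col M. M $$ (i, j) \<in> {0, 1})"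
  unfolding zero_one_mat_def elements_mat_def by (auto simp: image_iff subset_iff) fastforce+

text \<open>There are c * (r - s) ones among c * r entries, and c cancels. The count is done in
  \<open>int\<close> to avoid truncated subtraction.\<close>

lemma dense_complement_iff:
  assumes "const_col_mat s r c X" and "c > 0"
  shows "dense_mat (complement_mat X) \<longleftrightarrow> 2 * s < r"
proof -
  note dims = const_col_mat_dim[OF assms(1)]
  have zo: "complement_mat X $$ (i, j) \<in> {0, 1}" if "i < r" "j < c" for i j
    using assms(1) that dims by (auto simp: const_col_mat_def)
  have "int (entry_count 1 (complement_mat X)) = (\<Sum>j<c. \<Sum>i<r. complement_mat X $$ (i, j))"
    by (subst entry_count_1_eq_sum) (use zo dims in auto)
  also have "\<dots> = (\<Sum>j<c. int r - int s)"
    using assms(1) dims by (intro sum.cong) (simp_all add: sum_subtractf const_col_mat_def)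
  finally have count: "int (entry_count 1 (complement_mat X)) = int c * (int r - int s)"
    by simp
  have "r * c < 2 * entry_count 1 (complement_mat X)
      \<longleftrightarrow> int c * int r < int c * (2 * (int r - int s))"
    unfolding of_nat_less_iff[where 'a = int, symmetric] of_nat_mult count
    by (simp add: algebra_simps)
  also have "\<dots> \<longleftrightarrow> 2 * s < r"
    using assms(2) by (subst mult_less_cancel_left_pos) auto
  finally show ?thesis
    using zo dims by (simp add: dense_mat_def zero_one_mat_iff)
qed

text \<open>The binomial is n + 1 for k = 1, 1 for n = 0 and k + 1 for n = 1, and k = n = 2 gives
  the tie 6 = 6. All other pairs reduce to a binomial with lower index 2.\<close>

lemma double_less_choose_iff:
  assumes "k \<ge> 1"
  shows "2 * Suc n < (k + n) choose n
    \<longleftrightarrow> k \<ge> 2 \<and> n \<ge> 1 \<and> (k, n) \<notin> {(2, 1), (2, 2), (3, 1)}"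
proof -
  have two: "2 * ((m + 2) choose 2) = (m + 2) * (m + 1)" for m :: nat
    by (simp add: choose_two)
  consider "k = 1" | "n = 0" | "n = 1" | "k = 2" "n = 2" | "k \<ge> 2" "n \<ge> 3" | "k \<ge> 3" "n = 2"
    using assms by linarith
  then show ?thesis
  proof cases
    case 5
    \<comment> \<open>Monotonicity in k reduces this case to k = 2. Doubling clears the denominator,
      and n \<ge> 3 gives 4 < n + 2.\<close>
    have "4 * Suc n < (n + 2) * (n + 1)"
    proof -
      have "5 * (n + 1) \<le> (n + 2) * (n + 1)" using 5 by (intro mult_right_mono) auto
      then show ?thesis by simp
    qed
    also have "\<dots> = 2 * ((2 + n) choose n)"
      using two[of n] binomial_symmetric[of n "2 + n"] by (simp add: add.commute)
    also have "\<dots> \<le> 2 * ((k + n) choose n)"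
      using 5 by (intro mult_left_mono binomial_right_mono) auto
    finally show ?thesis using 5 by simp
  next
    case 6
    have "5 * 4 \<le> (k + 2) * (k + 1)" using 6 by (intro mult_mono) auto
    then show ?thesis using 6 two[of k] by simp
  qed (use assms two[of 2] in auto)
qed

text \<open>With dense read as a strict majority of ones, density has exceptions, hence the
  equivalence: for k = 1 or l = 1 the matrix \<open>B_mat k (int l - 2)\<close> is zero, for (2, 2)
  a third of its entries are ones, and for (2, 3) and (3, 2) exactly half are.\<close>

theorem theorem4p2:
  fixes k l :: nat
  assumes "k \<ge> 1" and "l \<ge> 1"
  shows "zero_one_mat (B_mat k (int l - 2))
    \<and> (dense_mat (B_mat k (int l - 2)) \<longleftrightarrow>
         k \<ge> 2 \<and> l \<ge> 2 \<and> (k, l) \<notin> {(2, 2), (2, 3), (3, 2)})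
    \<and> dim_row (B_mat k (int l - 2)) = dim_row (A_mat k (int l - 2))
    \<and> dim_col (B_mat k (int l - 2)) = dim_col (A_mat k (int l - 2))
    \<and> B_mat k (int l - 2) =
         all_ones (dim_row (A_mat k (int l - 2))) (dim_col (A_mat k (int l - 2)))
         - A_mat k (int l - 2)"
proof -
  obtain n where l: "l = Suc n" using assms(2) by (cases l) auto
  have j: "int l - 2 = int n - 1" using l by simp
  let ?A = "A_mat k (int n - 1)"
  have A: "const_col_mat (Suc n) ((k + n) choose n) ((k + n) choose Suc n) ?A"
    by (rule const_col_A_mat)
  have "zero_one_mat (complement_mat ?A)"
    using A const_col_mat_dim[OF A] by (auto simp: zero_one_mat_iff const_col_mat_def)
  \<comment> \<open>The matrix has a column because \<open>Suc n\<close> is at most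
    \<open>k + n\<close> when k is positive.\<close>
  moreover have "dense_mat (complement_mat ?A) \<longleftrightarrow> 2 * Suc n < (k + n) choose n"
    using assms(1) by (intro dense_complement_iff[OF A]) (simp add: zero_less_binomial_iff)
  moreover have "\<dots> \<longleftrightarrow> k \<ge> 2 \<and> l \<ge> 2 \<and> (k, l) \<notin> {(2, 2), (2, 3), (3, 2)}"
    unfolding double_less_choose_iff[OF assms(1)] using l by auto
  ultimately show ?thesis
    unfolding j B_mat_eq_complement by (simp add: complement_mat_def[symmetric])
qed

end
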